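(* Let $G$ be a group, let $Q$ be a quasi-normal subgroup of $G$ and let $N$ be a normal subgroup of $G$. Then the subgroup $\langle Q\cup N\rangle$ of $G$ generated by $Q$ and $N$ is quasi-normal in $G$. Furthermore, one can choose a transversal $T$ for $N$ in $\langle Q\cup N\rangle$ with $T\subset Q$, together with commensuration data for $(g,Q,G)$ and for $(g,\langle Q\cup N\rangle,G)$ for every $g\in G$, such that for all $g\in G$, $t\in T$ and $n\in N$: $$\alpha_{(g,\langle Q\cup N\rangle,G)}(tn)=\alpha_{(g,Q,G)}(t)\quad\text{and}\quad \beta_{(g,\langle Q\cup N\rangle,G)}(tn)=\beta_{(g,Q,G)}(t).$$
   Context: For a subgroup $H$ of a group $G$, the commensurator of $H$ in $G$ is $Comm(H,G)=\{g\in G : gHg^{-1}\cap H \text{ has finite index in both } H \text{ and } gHg^{-1}\}$. A subgroup $Q$ of $G$ is quasi-normal in $G$ if $Comm(Q,G)=G$. For $g\in Comm(H,G)$, commensuration data for $(g,H,G)$ means a finite subset $A(g,H,G)$ of $HgH$ and functions $\alpha_{(g,H,G)}:H\to A(g,H,G)$ and $\beta_{(g,H,G)}:H\to (A(g,H,G))^{-1}$ such that: for each $h\in H$, $h\,\alpha_{(g,H,G)}(h)\in gH$ and $gh\,\beta_{(g,H,G)}(h)\in H$; $\mathrm{image}(\alpha_{(g,H,G)})\cup(\mathrm{image}(\beta_{(g,H,G)}))^{-1}=A(g,H,G)$; and for each $a\in A(g,H,G)$ there are $h_1,h_2\in H$ with $h_1a\in gH$ and $gh_2a^{-1}\in H$.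 Such data exist for every $g\in Comm(H,G)$ but are not unique. A transversal for $N$ in $K\supset N$ is a set $T\subset K$ containing exactly one element of each coset of $N$ in $K$, so each element of $K$ is uniquely $tn$ with $t\in T$, $n\in N$. *)

theory Defs
  imports "HOL-Algebra.Algebra"
begin

text \<open>
  The index of \<open>K\<close> in \<open>H\<close> is counted by the cosets of \<open>K\<close> in the group with carrier \<open>H\<close>;
  this is meant for subgroups \<open>K \<subseteq> H\<close> of \<open>G\<close>.
\<close>
definition finite_index :: "('a, 'b) monoid_scheme \<Rightarrow> 'a set \<Rightarrow> 'a set \<Rightarrow> bool" where
  "finite_index G K H \<longleftrightarrow> finite (rcosets\<^bsub>G\<lparr>carrier := H\<rparr>\<^esub> K)"

definition conj_subgroup :: "('a, 'b) monoid_scheme \<Rightarrow> 'a \<Rightarrow> 'a set \<Rightarrow> 'a set" where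
  "conj_subgroup G g H = (g <#\<^bsub>G\<^esub> H) #>\<^bsub>G\<^esub> inv\<^bsub>G\<^esub> g"

definition commensurator :: "'a set \<Rightarrow> ('a, 'b) monoid_scheme \<Rightarrow> 'a set" where
  "commensurator H G = {g \<in> carrier G.
     finite_index G (conj_subgroup G g H \<inter> H) H \<and>
     finite_index G (conj_subgroup G g H \<inter> H) (conj_subgroup G g H)}"

definition quasi_normal :: "'a set \<Rightarrow> ('a, 'b) monoid_scheme \<Rightarrow> bool" where
  "quasi_normal Q G \<longleftrightarrow> subgroup Q G \<and> commensurator Q G = carrier G"

text \<open>
  The values of \<open>\<alpha>\<close> and \<open>\<beta>\<close> matter only on \<open>H\<close>.
\<close>
definition commensuration_data ::
    "'a \<Rightarrow> 'a set \<Rightarrow> ('a, 'b) monoid_scheme \<Rightarrow> 'a set \<Rightarrow> ('a \<Rightarrow> 'a) \<Rightarrow> ('a \<Rightarrow> 'a) \<Rightarrow> bool" where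
  "commensuration_data g H G A \<alpha> \<beta> \<longleftrightarrow>
     g \<in> commensurator H G \<and>
     finite A \<and> A \<subseteq> (H #>\<^bsub>G\<^esub> g) <#>\<^bsub>G\<^esub> H \<and>
     \<alpha> \<in> H \<rightarrow> A \<and> \<beta> \<in> H \<rightarrow> set_inv\<^bsub>G\<^esub> A \<and>
     (\<forall>h\<in>H. h \<otimes>\<^bsub>G\<^esub> \<alpha> h \<in> g <#\<^bsub>G\<^esub> H \<and> g \<otimes>\<^bsub>G\<^esub> h \<otimes>\<^bsub>G\<^esub> \<beta> h \<in> H) \<and>
     \<alpha> ` H \<union> set_inv\<^bsub>G\<^esub> (\<beta> ` H) = A \<and>
     (\<forall>a\<in>A. \<exists>h\<^sub>1\<in>H. \<exists>h\<^sub>2\<in>H.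
        h\<^sub>1 \<otimes>\<^bsub>G\<^esub> a \<in> g <#\<^bsub>G\<^esub> H \<and> g \<otimes>\<^bsub>G\<^esub> h\<^sub>2 \<otimes>\<^bsub>G\<^esub> inv\<^bsub>G\<^esub> a \<in> H)"

text \<open>
  Cosets are left cosets \<open>k N\<close>, so that elements of \<open>K\<close> factor as \<open>t n\<close> with
  \<open>t \<in> T\<close> and \<open>n \<in> N\<close>.
\<close>
definition transversal :: "'a set \<Rightarrow> 'a set \<Rightarrow> 'a set \<Rightarrow> ('a, 'b) monoid_scheme \<Rightarrow> bool" where
  "transversal T N K G \<longleftrightarrow>
     T \<subseteq> K \<and> (\<forall>k\<in>K. \<exists>!t. t \<in> T \<and> t \<in> k <#\<^bsub>G\<^esub> N)"

end

theory Submission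
  imports Defs
begin

text \<open>
  By normality \<open>\<langle>Q \<union> N\<rangle> = Q N\<close>, so \<open>N\<close> has a transversal \<open>T \<subseteq> Q\<close> in it, and an element \<open>n \<in> N\<close> can be
  moved past any \<open>a \<in> G\<close> at the cost of replacing it by another element of \<open>N\<close>. Hence if \<open>\<alpha>, \<beta>\<close> are
  commensuration data for \<open>(g, Q, G)\<close>, then \<open>t n \<mapsto> \<alpha> t\<close> and \<open>t n \<mapsto> \<beta> t\<close> are commensuration data for
  \<open>(g, Q N, G)\<close>. That \<open>g\<close> commensurates \<open>Q N\<close> comes out of the same data: the cosets of \<open>gHg\<inverse> \<inter> H\<close> in
  \<open>H\<close> and in \<open>gHg\<inverse>\<close> are separated by the finitely many values of \<open>\<alpha>\<close> and \<open>\<beta>\<close>.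
\<close>

context group
begin

section \<open>Finite index, separating maps and coset representatives\<close>

lemma inv_mult_cancel:
  assumes "x \<in> carrier G" "y \<in> carrier G"
  shows "inv x \<otimes> (x \<otimes> y) = y" "x \<otimes> (inv x \<otimes> y) = y"
  using assms by (simp_all flip: m_assoc)

text \<open>Elements with the same label \<open>c\<close> lie in the same right coset of
  \<open>J\<close>, so there are at most as many cosets as labels.\<close>

lemma finite_index_if_finite_image:
  assumes J: "subgroup J G" and H: "H \<subseteq> carrier G"
    and fin: "finite (c ` H)"
    and c: "\<And>x y. x \<in> H \<Longrightarrow> y \<in> H \<Longrightarrow> c x = c y \<Longrightarrow> x \<otimes> inv y \<in> J"
  shows "finite_index G J H"
proof -
  \<comment> \<open>\<open>s\<close> picks one element of \<open>H\<close> for each label, so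
    \<open>v \<mapsto> J #> s v\<close> reaches every coset \<open>J #> x\<close> with
    \<open>x \<in> H\<close>.\<close>
  define s where "s v = (SOME x. x \<in> H \<and> c x = v)" for v
  have "J #> x \<in> (\<lambda>v. J #> s v) ` c ` H" if x: "x \<in> H" for x
  proof -
    have s: "s (c x) \<in> H \<and> c (s (c x)) = c x"
      unfolding s_def by (rule someI[of _ x]) (use x in simp)
    then have "x \<otimes> inv (s (c x)) \<in> J"
      using c x by metis
    then have "x \<in> J #> s (c x)"
      using s x H by (auto simp: r_coset_def m_assoc subsetD intro!: bexI[of _ "x \<otimes> inv (s (c x))"])
    then have "J #> x = J #> s (c x)"
      using s H J by (metis repr_independence subsetD)
    then show ?thesis using x by blast
  qed
  \<comment> \<open>Replacing the carrier leaves the multiplication unchanged, so the cosets in the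
    restricted group are the sets \<open>J #> x\<close> with \<open>x \<in> H\<close>, formed in
    \<open>G\<close>.\<close>
  then have "rcosets\<^bsub>G\<lparr>carrier := H\<rparr>\<^esub> J \<subseteq> (\<lambda>v. J #> s v) ` c ` H"
    by (auto simp: RCOSETS_def r_coset_def)
  then show ?thesis
    unfolding finite_index_def using fin finite_subset by blast
qed

lemma finite_index_representatives:
  assumes J: "subgroup J G" and H: "H \<subseteq> carrier G" and fin: "finite_index G J H"
  obtains r where "r ` H \<subseteq> H" "finite (r ` H)" "\<And>x. x \<in> H \<Longrightarrow> x \<otimes> inv (r x) \<in> J"
proof
  \<comment> \<open>The choice depends on \<open>x\<close> only through \<open>J #> x\<close>, so
    \<open>r\<close> takes at most one value per coset and has finite image.\<close>
  define r where "r x = (SOME y. y \<in> H \<and> J #> y = J #> x)" for x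
  have r: "r x \<in> H \<and> J #> r x = J #> x" if "x \<in> H" for x
    unfolding r_def by (rule someI[of _ x]) (use that in simp)
  then show "r ` H \<subseteq> H" by blast
  have "r ` H \<subseteq> (\<lambda>C. SOME y. y \<in> H \<and> J #> y = C) ` (rcosets\<^bsub>G\<lparr>carrier := H\<rparr>\<^esub> J)"
    by (auto simp: r_def RCOSETS_def r_coset_def)
  then show "finite (r ` H)"
    using fin unfolding finite_index_def using finite_surj by blast
  show "x \<otimes> inv (r x) \<in> J" if x: "x \<in> H" for x
  proof -
    have "x \<in> J #> r x"
      using r[OF x] x H J by (metis rcos_self subsetD)
    then obtain j where "j \<in> J" "x = j \<otimes> r x" by (auto simp: r_coset_def)
    then show ?thesis
      using r[OF x] H J by (metis inv_solve_right subgroup.mem_carrier subsetD x)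
  qed
qed

section \<open>Conjugate subgroups and commensuration data\<close>

lemma conj_subgroup_iff:
  assumes "g \<in> carrier G" "H \<subseteq> carrier G"
  shows "x \<in> conj_subgroup G g H \<longleftrightarrow> (\<exists>h\<in>H. x = g \<otimes> h \<otimes> inv g)"
  using assms by (auto simp: conj_subgroup_def l_coset_def r_coset_def)

lemma subgroup_conj_subgroup:
  assumes g: "g \<in> carrier G" and H: "subgroup H G"
  shows "subgroup (conj_subgroup G g H) G"
proof -
  have sub: "H \<subseteq> carrier G" using H by (rule subgroup.subset)
  note iff = conj_subgroup_iff[OF g sub]
  show ?thesis
  proof (rule subgroupI)
    show "conj_subgroup G g H \<subseteq> carrier G" using g subsetD[OF sub] by (auto simp: iff)
    show "conj_subgroup G g H \<noteq> {}" using subgroup.one_closed[OF H] by (auto simp: iff ex_in_conv[symmetric])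
  next
    fix x assume "x \<in> conj_subgroup G g H"
    then obtain h where h: "h \<in> H" "x = g \<otimes> h \<otimes> inv g" by (auto simp: iff)
    have "inv x = g \<otimes> inv h \<otimes> inv g"
      using h g by (simp add: inv_mult_group m_assoc subsetD[OF sub])
    then show "inv x \<in> conj_subgroup G g H"
      using h subgroup.m_inv_closed[OF H] by (auto simp: iff)
  next
    fix x y assume "x \<in> conj_subgroup G g H" "y \<in> conj_subgroup G g H"
    then obtain h k where h: "h \<in> H" "x = g \<otimes> h \<otimes> inv g" and k: "k \<in> H" "y = g \<otimes> k \<otimes> inv g"
      by (auto simp: iff)
    have "x \<otimes> y = g \<otimes> (h \<otimes> k) \<otimes> inv g"
      using h k g by (simp add: m_assoc inv_mult_cancel subsetD[OF sub])
    then show "x \<otimes> y \<in> conj_subgroup G g H"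
      using h k subgroup.m_closed[OF H] by (auto simp: iff)
  qed
qed

text \<open>\<open>\<alpha>\<close> labels the cosets in \<open>H\<close> and \<open>\<beta>\<close>
  those in the conjugate: when two labels agree, the common factor cancels in a quotient of the two
  membership conditions, leaving \<open>x \<otimes> inv y\<close> in the intersection.\<close>

lemma in_commensuratorI:
  assumes H: "subgroup H G" and g: "g \<in> carrier G"
    and fin: "finite (\<alpha> ` H)" "finite (\<beta> ` H)"
    and car: "\<alpha> ` H \<subseteq> carrier G" "\<beta> ` H \<subseteq> carrier G"
    and \<alpha>: "\<And>h. h \<in> H \<Longrightarrow> h \<otimes> \<alpha> h \<in> g <# H"
    and \<beta>: "\<And>h. h \<in> H \<Longrightarrow> g \<otimes> h \<otimes> \<beta> h \<in> H"
  shows "g \<in> commensurator H G"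
proof -
  have sub: "H \<subseteq> carrier G" using H by (rule subgroup.subset)
  note iff = conj_subgroup_iff[OF g sub]
  let ?C = "conj_subgroup G g H"
  have C: "subgroup ?C G" by (rule subgroup_conj_subgroup[OF g H])
  have J: "subgroup (?C \<inter> H) G" by (rule subgroups_Inter_pair[OF C H])
  have "finite_index G (?C \<inter> H) H"
  proof (rule finite_index_if_finite_image[OF J sub fin(1)])
    fix x y assume x: "x \<in> H" and y: "y \<in> H" and eq: "\<alpha> x = \<alpha> y"
    obtain h k where h: "h \<in> H" "x \<otimes> \<alpha> x = g \<otimes> h" and k: "k \<in> H" "y \<otimes> \<alpha> x = g \<otimes> k"
      using \<alpha>[OF x] \<alpha>[OF y] eq by (auto simp: l_coset_def)
    have c: "x \<in> carrier G" "y \<in> carrier G" "h \<in> carrier G" "k \<in> carrier G" "\<alpha> x \<in> carrier G"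
      using x y h k sub car by auto
    have "x \<otimes> inv y = (x \<otimes> \<alpha> x) \<otimes> inv (y \<otimes> \<alpha> x)"
      using c by (simp add: inv_mult_group m_assoc inv_mult_cancel)
    also have "\<dots> = g \<otimes> (h \<otimes> inv k) \<otimes> inv g"
      unfolding h k using c g by (simp add: inv_mult_group m_assoc)
    finally have "x \<otimes> inv y \<in> ?C"
      using h k H by (auto simp: iff intro: subgroup.m_closed subgroup.m_inv_closed)
    then show "x \<otimes> inv y \<in> ?C \<inter> H"
      using x y H by (auto intro: subgroup.m_closed subgroup.m_inv_closed)
  qed
  moreover have "finite_index G (?C \<inter> H) ?C"
  \<comment> \<open>An element \<open>g \<otimes> h \<otimes> inv g\<close> of the conjugate is
    labelled by \<open>\<beta> h\<close>; conjugating back by \<open>g\<close> recovers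
    \<open>h\<close>.\<close>
  proof (rule finite_index_if_finite_image[OF J subgroup.subset[OF C], of "\<lambda>x. \<beta> (inv g \<otimes> x \<otimes> g)"])
    have *: "inv g \<otimes> (g \<otimes> h \<otimes> inv g) \<otimes> g = h" if "h \<in> H" for h
      using that g by (simp add: m_assoc inv_mult_cancel subsetD[OF sub])
    have "(\<lambda>x. \<beta> (inv g \<otimes> x \<otimes> g)) ` ?C \<subseteq> \<beta> ` H"
      by (auto simp: iff *)
    then show "finite ((\<lambda>x. \<beta> (inv g \<otimes> x \<otimes> g)) ` ?C)"
      using fin(2) finite_subset by blast
    fix x y assume x: "x \<in> ?C" and y: "y \<in> ?C" and eq: "\<beta> (inv g \<otimes> x \<otimes> g) = \<beta> (inv g \<otimes> y \<otimes> g)"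
    obtain h k where h: "h \<in> H" "x = g \<otimes> h \<otimes> inv g" and k: "k \<in> H" "y = g \<otimes> k \<otimes> inv g"
      using x y by (auto simp: iff)
    have eq': "\<beta> h = \<beta> k" using eq h k by (simp add: *)
    have c: "h \<in> carrier G" "k \<in> carrier G" "\<beta> k \<in> carrier G" using h k sub car by auto
    \<comment> \<open>The shared value \<open>\<beta> k\<close> is inserted and cancelled, which
      turns \<open>x \<otimes> inv y\<close> into a quotient of two elements of
      \<open>H\<close>.\<close>
    have "x \<otimes> inv y = g \<otimes> h \<otimes> \<beta> k \<otimes> inv (g \<otimes> k \<otimes> \<beta> k)"
      unfolding h k using c g by (simp add: inv_mult_group m_assoc inv_mult_cancel)
    moreover have "\<dots> \<in> H"
      using \<beta>[OF h(1)] \<beta>[OF k(1)] eq' H by (metis subgroup.m_closed subgroup.m_inv_closed)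
    moreover have "x \<otimes> inv y \<in> ?C"
      using x y C by (auto intro: subgroup.m_closed subgroup.m_inv_closed)
    ultimately show "x \<otimes> inv y \<in> ?C \<inter> H" by simp
  qed
  ultimately show ?thesis using g by (simp add: commensurator_def)
qed

text \<open>The union condition forces the choice of \<open>A\<close>. The remaining existence
  clause holds for every element of the double coset HgH, so only finiteness, location and the two
  membership conditions have to be supplied.\<close>

lemma commensuration_dataI:
  assumes H: "subgroup H G" and g: "g \<in> carrier G"
    and fin: "finite (\<alpha> ` H)" "finite (\<beta> ` H)"
    and car: "\<alpha> ` H \<subseteq> H #> g <#> H" "\<beta> ` H \<subseteq> set_inv (H #> g <#> H)"
    and \<alpha>: "\<And>h. h \<in> H \<Longrightarrow> h \<otimes> \<alpha> h \<in> g <# H"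
    and \<beta>: "\<And>h. h \<in> H \<Longrightarrow> g \<otimes> h \<otimes> \<beta> h \<in> H"
  shows "commensuration_data g H G (\<alpha> ` H \<union> set_inv (\<beta> ` H)) \<alpha> \<beta>"
proof -
  have sub: "H \<subseteq> carrier G" using H by (rule subgroup.subset)
  let ?D = "H #> g <#> H"
  have Dc: "?D \<subseteq> carrier G" using sub g by (simp add: r_coset_subset_G set_mult_closed)
  have iDc: "set_inv ?D \<subseteq> carrier G" using Dc by (auto simp: SET_INV_def)
  have \<beta>c: "\<beta> h \<in> carrier G" if "h \<in> H" for h using that car(2) iDc by auto
  have g': "g \<in> commensurator H G"
    using in_commensuratorI[OF H g fin _ _ \<alpha> \<beta>] car Dc iDc by blast
  have inv_eq: "set_inv B = (\<lambda>x. inv x) ` B" for B by (auto simp: SET_INV_def)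
  have A: "\<alpha> ` H \<union> set_inv (\<beta> ` H) \<subseteq> ?D" (is "?A \<subseteq> _")
  proof -
    have "inv (\<beta> h) \<in> ?D" if h: "h \<in> H" for h
    proof -
      obtain d where "d \<in> ?D" "\<beta> h = inv d" using h car(2) by (auto simp: inv_eq)
      then show ?thesis using Dc by auto
    qed
    then show ?thesis using car(1) by (auto simp: inv_eq)
  qed
  have "finite ?A" using fin by (simp add: inv_eq)
  moreover have "\<beta> h \<in> set_inv ?A" if "h \<in> H" for h
  proof -
    have "\<beta> h = inv (inv (\<beta> h))" using \<beta>c[OF that] by simp
    then show ?thesis using that unfolding inv_eq by blast
  qed
  moreover have "\<exists>h\<^sub>1\<in>H. \<exists>h\<^sub>2\<in>H. h\<^sub>1 \<otimes> a \<in> g <# H \<and> g \<otimes> h\<^sub>2 \<otimes> inv a \<in> H" if a: "a \<in> ?A" for a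
  proof -
    \<comment> \<open>With \<open>a = p \<otimes> g \<otimes> q\<close>, the witnesses are
      \<open>inv p\<close> and \<open>q\<close>, since p^-1 a = g q and g q a^-1 = p^-1.\<close>
    obtain p q where p: "p \<in> H" and q: "q \<in> H" and a: "a = p \<otimes> g \<otimes> q"
      using A a by (auto simp: r_coset_def set_mult_def)
    have c: "p \<in> carrier G" "q \<in> carrier G" using p q sub by auto
    have "inv p \<otimes> a = g \<otimes> q" using c g by (simp add: a m_assoc inv_mult_cancel)
    moreover have "g \<otimes> q \<otimes> inv a = inv p" using c g by (simp add: a inv_mult_group m_assoc inv_mult_cancel)
    moreover have "inv p \<in> H" using p H by (simp add: subgroup.m_inv_closed)
    ultimately show ?thesis using q by (intro bexI[of _ "inv p"] bexI[of _ q]) (auto simp: l_coset_def)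
  qed
  ultimately show ?thesis
    unfolding commensuration_data_def using g' A \<alpha> \<beta> by auto
qed

text \<open>Finitely many representatives of the cosets of the intersection in \<open>H\<close>
  yield \<open>\<alpha>\<close>, and those in the conjugate yield \<open>\<beta>\<close>.\<close>

lemma commensuration_data_exists:
  assumes H: "subgroup H G" and g: "g \<in> commensurator H G"
  shows "\<exists>A \<alpha> \<beta>. commensuration_data g H G A \<alpha> \<beta>"
proof -
  have gc: "g \<in> carrier G" using g by (simp add: commensurator_def)
  have sub: "H \<subseteq> carrier G" using H by (rule subgroup.subset)
  note iff = conj_subgroup_iff[OF gc sub]
  let ?C = "conj_subgroup G g H"
  have C: "subgroup ?C G" by (rule subgroup_conj_subgroup[OF gc H])
  have J: "subgroup (?C \<inter> H) G" by (rule subgroups_Inter_pair[OF C H])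
  obtain r where r: "r ` H \<subseteq> H" "finite (r ` H)" "\<And>x. x \<in> H \<Longrightarrow> x \<otimes> inv (r x) \<in> ?C \<inter> H"
    using finite_index_representatives[OF J sub] g by (auto simp: commensurator_def)
  obtain s where s: "s ` ?C \<subseteq> ?C" "finite (s ` ?C)" "\<And>x. x \<in> ?C \<Longrightarrow> x \<otimes> inv (s x) \<in> ?C \<inter> H"
    using finite_index_representatives[OF J subgroup.subset[OF C]] g by (auto simp: commensurator_def)
  \<comment> \<open>Here \<open>h \<otimes> \<alpha> h\<close> is
    \<open>h \<otimes> inv (r h)\<close>, an element of gHg^-1, times \<open>g\<close>, hence in gH.
    Likewise \<open>g \<otimes> h \<otimes> \<beta> h\<close> is ghg^-1 times the inverse of its
    representative, hence in \<open>H\<close>.\<close>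
  define \<alpha> where "\<alpha> h = inv (r h) \<otimes> g" for h
  define \<beta> where "\<beta> h = inv g \<otimes> inv (s (g \<otimes> h \<otimes> inv g))" for h
  have hC: "g \<otimes> h \<otimes> inv g \<in> ?C" if "h \<in> H" for h using that by (auto simp: iff)
  have one: "\<one> \<in> H" using H by (rule subgroup.one_closed)
  have "commensuration_data g H G (\<alpha> ` H \<union> set_inv (\<beta> ` H)) \<alpha> \<beta>"
  proof (rule commensuration_dataI[OF H gc])
    have "\<alpha> ` H = (\<lambda>x. inv x \<otimes> g) ` r ` H" by (auto simp: \<alpha>_def)
    then show "finite (\<alpha> ` H)" using r(2) by simp
    have "\<beta> ` H \<subseteq> (\<lambda>x. inv g \<otimes> inv x) ` s ` ?C" using hC by (auto simp: \<beta>_def)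
    then show "finite (\<beta> ` H)" using s(2) finite_surj by blast
    show "\<alpha> ` H \<subseteq> H #> g <#> H"
    proof safe
      fix h assume "h \<in> H"
      then have "inv (r h) \<in> H" using r(1) H by (auto intro: subgroup.m_inv_closed)
      moreover from this have "\<alpha> h = inv (r h) \<otimes> g \<otimes> \<one>" using gc sub by (auto simp: \<alpha>_def)
      ultimately show "\<alpha> h \<in> H #> g <#> H" using one by (auto simp: r_coset_def set_mult_def)
    qed
    show "\<beta> ` H \<subseteq> set_inv (H #> g <#> H)"
    proof safe
      fix h assume "h \<in> H"
      then have "s (g \<otimes> h \<otimes> inv g) \<in> ?C" using hC s(1) by auto
      then obtain k where k: "k \<in> H" "s (g \<otimes> h \<otimes> inv g) = g \<otimes> k \<otimes> inv g"
        by (auto simp: iff)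
      have kc: "k \<in> carrier G" using k sub by auto
      \<comment> \<open>Since the representative is gkg^-1, \<open>\<beta> h\<close> collapses to
        (gk)^-1; \<open>\<one>\<close> serves as the left factor from \<open>H\<close> in the double
        coset.\<close>
      then have "\<beta> h = inv (\<one> \<otimes> g \<otimes> k)"
        using k gc by (simp add: \<beta>_def inv_mult_group m_assoc inv_mult_cancel)
      moreover have "\<one> \<otimes> g \<otimes> k \<in> H #> g <#> H" using one k by (auto simp: r_coset_def set_mult_def)
      ultimately show "\<beta> h \<in> set_inv (H #> g <#> H)" by (auto simp: SET_INV_def)
    qed
    fix h assume h: "h \<in> H"
    have rc: "r h \<in> carrier G" using r(1) h sub by auto
    obtain k where k: "k \<in> H" "h \<otimes> inv (r h) = g \<otimes> k \<otimes> inv g"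
      using r(3)[OF h] by (auto simp: iff)
    have c: "h \<in> carrier G" "k \<in> carrier G" using h k sub by auto
    have "h \<otimes> \<alpha> h = h \<otimes> inv (r h) \<otimes> g" using c rc gc by (simp add: \<alpha>_def m_assoc)
    also have "\<dots> = g \<otimes> k" unfolding k using c gc by (simp add: m_assoc)
    finally show "h \<otimes> \<alpha> h \<in> g <# H" using k by (auto simp: l_coset_def)
    have "s (g \<otimes> h \<otimes> inv g) \<in> carrier G" using s(1) hC[OF h] subgroup.subset[OF C] by auto
    then have "g \<otimes> h \<otimes> \<beta> h = g \<otimes> h \<otimes> inv g \<otimes> inv (s (g \<otimes> h \<otimes> inv g))"
      using c gc by (simp add: \<beta>_def m_assoc)
    then show "g \<otimes> h \<otimes> \<beta> h \<in> H" using s(3)[OF hC[OF h]] by simp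
  qed
  then show ?thesis by blast
qed

section \<open>The product \<open>Q <#> N\<close>, its transversal and its commensuration
  data\<close>

lemma generate_Un_normal:
  assumes Q: "subgroup Q G" and N: "N \<lhd> G"
  shows "generate G (Q \<union> N) = Q <#> N"
proof
  \<comment> \<open>Normality makes \<open>N <#> Q\<close> a subgroup and lets the factors be
    exchanged.\<close>
  have sub: "subgroup (Q <#> N) G"
    using mult_norm_subgroup[OF N Q] commut_normal[OF Q N] by simp
  have Ns: "subgroup N G" using N by (rule normal_imp_subgroup)
  have "Q \<union> N \<subseteq> Q <#> N"
  proof -
    have "q \<in> Q <#> N" if "q \<in> Q" for q
      using that subgroup.mem_carrier[OF Q] subgroup.one_closed[OF Ns]
      by (force simp: set_mult_def)
    moreover have "n \<in> Q <#> N" if "n \<in> N" for n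
      using that subgroup.mem_carrier[OF Ns] subgroup.one_closed[OF Q]
      by (force simp: set_mult_def)
    ultimately show ?thesis by blast
  qed
  then show "generate G (Q \<union> N) \<subseteq> Q <#> N"
    using generate_subgroup_incl sub by simp
  show "Q <#> N \<subseteq> generate G (Q \<union> N)"
    unfolding set_mult_def by (blast intro: generate.eng generate.incl)
qed

text \<open>Every coset of \<open>N\<close> in \<open>Q <#> N\<close> meets \<open>Q\<close>,
  because qnN = qN. The map \<open>p\<close> is the projection tn \<mapsto> t, through which
  functions on \<open>Q\<close> extend to the product.\<close>

lemma transversal_projection:
  assumes Q: "subgroup Q G" and N: "subgroup N G"
  obtains T p where "T \<subseteq> Q" "transversal T N (Q <#> N) G"
    "\<And>k. k \<in> Q <#> N \<Longrightarrow> p k \<in> T \<and> k \<in> p k <# N"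
    "\<And>t n. t \<in> T \<Longrightarrow> n \<in> N \<Longrightarrow> p (t \<otimes> n) = t"
proof -
  \<comment> \<open>The choice depends only on the coset \<open>k <# N\<close>, so \<open>p\<close>
    is constant on cosets and its image has one element in each.\<close>
  define p where "p k = (SOME q. q \<in> Q \<and> q <# N = k <# N)" for k
  define T where "T = p ` (Q <#> N)"
  have Qc: "Q \<subseteq> carrier G" and Nc: "N \<subseteq> carrier G"
    using Q N by (auto dest: subgroup.subset)
  have coset: "(q \<otimes> n) <# N = q <# N" if "q \<in> carrier G" "n \<in> N" for q n
    using that l_repr_independence[OF _ _ N, of "q \<otimes> n" q] by (auto simp: l_coset_def)
  have self: "k \<in> k <# N" if "k \<in> carrier G" for k
    using that subgroup.one_closed[OF N] by (force simp: l_coset_def)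
  have p: "p k \<in> Q \<and> p k <# N = k <# N" if k: "k \<in> Q <#> N" for k
  proof -
    obtain q n where "q \<in> Q" "n \<in> N" "k = q \<otimes> n" using k by (auto simp: set_mult_def)
    then have "q \<in> Q \<and> q <# N = k <# N" using coset Qc by auto
    then show ?thesis unfolding p_def by (rule someI)
  qed
  have pp: "p k = p l" if "k <# N = l <# N" for k l
    using that by (simp add: p_def)
  have Kc: "Q <#> N \<subseteq> carrier G" using Qc Nc by (rule set_mult_closed)
  have QK: "Q \<subseteq> Q <#> N"
    using Qc subgroup.one_closed[OF N] by (force simp: set_mult_def)
  have T: "T \<subseteq> Q" using p by (auto simp: T_def)
  have pT: "p t = t" if t: "t \<in> T" for t
  proof -
    obtain k where "k \<in> Q <#> N" "t = p k" using t by (auto simp: T_def)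
    \<comment> \<open>\<open>t = p k\<close> lies in the coset of \<open>k\<close>, so both have the
      same value under \<open>p\<close>, namely \<open>t\<close>.\<close>
    then show ?thesis using p[of k] by (intro trans[OF pp[of t k]]) auto
  qed
  have eq: "t <# N = k <# N" if t: "t \<in> k <# N" and k: "k \<in> carrier G" for t k
  proof -
    obtain n where "n \<in> N" "t = k \<otimes> n" using t by (auto simp: l_coset_def)
    then show ?thesis using coset k by simp
  qed
  show thesis
  proof
    show "T \<subseteq> Q" by (rule T)
    show "p k \<in> T \<and> k \<in> p k <# N" if "k \<in> Q <#> N" for k
      using that p self Kc by (auto simp: T_def)
    show "p (t \<otimes> n) = t" if "t \<in> T" "n \<in> N" for t n
    proof -
      have "t \<in> carrier G" using that T Qc by blast
      then show ?thesis using pp[OF coset] pT that by simp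
    qed
    show "transversal T N (Q <#> N) G"
      unfolding transversal_def
    proof (intro conjI ballI ex1I)
      show "T \<subseteq> Q <#> N" using T QK by blast
      fix k assume k: "k \<in> Q <#> N"
      show "p k \<in> T" using k by (simp add: T_def)
      show "p k \<in> k <# N" using p[OF k] self[of "p k"] Qc by auto
      show "t = p k" if t: "t \<in> T \<and> t \<in> k <# N" for t
      proof -
        have "t <# N = k <# N" using t eq k Kc by blast
        then show ?thesis using pp pT t by metis
      qed
    qed
  qed
qed

text \<open>Write \<open>k = t \<otimes> n\<close> with \<open>t = p k\<close>. In k \<alpha>(t) = t
  n \<alpha>(t), the factor \<open>n\<close> moves to the right as some n1 in \<open>N\<close>, so
  the product lies in gQ n1, inside gQN; the same move treats \<open>\<beta>\<close>.\<close>

lemma commensuration_data_set_mult: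
  assumes Q: "subgroup Q G" and N: "N \<lhd> G"
    and data: "commensuration_data g Q G A \<alpha> \<beta>"
    and p: "\<And>k. k \<in> Q <#> N \<Longrightarrow> p k \<in> Q \<and> k \<in> p k <# N"
  shows "\<exists>A'. commensuration_data g (Q <#> N) G A' (\<alpha> \<circ> p) (\<beta> \<circ> p)"
proof -
  let ?K = "Q <#> N"
  have K: "subgroup ?K G"
    using mult_norm_subgroup[OF N Q] commut_normal[OF Q N] by simp
  have Ns: "subgroup N G" using N by (rule normal_imp_subgroup)
  have Qc: "Q \<subseteq> carrier G" and Nc: "N \<subseteq> carrier G"
    using Q Ns by (auto dest: subgroup.subset)
  have QK: "Q \<subseteq> ?K"
    using Qc subgroup.one_closed[OF Ns] by (force simp: set_mult_def)
  have g: "g \<in> carrier G" using data by (simp add: commensuration_data_def commensurator_def)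
  have A: "finite A" "A \<subseteq> Q #> g <#> Q" and \<alpha>A: "\<alpha> ` Q \<subseteq> A" and \<beta>A: "\<beta> ` Q \<subseteq> set_inv A"
    and \<alpha>: "\<And>h. h \<in> Q \<Longrightarrow> h \<otimes> \<alpha> h \<in> g <# Q" and \<beta>: "\<And>h. h \<in> Q \<Longrightarrow> g \<otimes> h \<otimes> \<beta> h \<in> Q"
    using data by (auto simp: commensuration_data_def)
  have mono: "Q #> g <#> Q \<subseteq> L #> g <#> L" if "Q \<subseteq> L" for L
    using that unfolding r_coset_def set_mult_def by blast
  have AK: "A \<subseteq> ?K #> g <#> ?K" using A(2) mono[OF QK] by (rule subset_trans)
  have Ac: "A \<subseteq> carrier G" using A(2) g Qc by (meson r_coset_subset_G set_mult_closed subset_trans)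
  have iA: "finite (set_inv A)" "set_inv A \<subseteq> set_inv (?K #> g <#> ?K)" "set_inv A \<subseteq> carrier G"
    using A(1) AK Ac by (auto simp: SET_INV_def)
  \<comment> \<open>The replacement for \<open>n\<close> is its conjugate x^-1 n x, which stays in
    the normal subgroup.\<close>
  have swap: "\<exists>n'\<in>N. n \<otimes> x = x \<otimes> n'" if n: "n \<in> N" and x: "x \<in> carrier G" for n x
  proof
    show "inv x \<otimes> n \<otimes> x \<in> N" using normal.inv_op_closed1[OF N x n] .
    show "n \<otimes> x = x \<otimes> (inv x \<otimes> n \<otimes> x)" using n x Nc by (auto simp: m_assoc inv_mult_cancel subsetD)
  qed
  have "commensuration_data g ?K G ((\<alpha> \<circ> p) ` ?K \<union> set_inv ((\<beta> \<circ> p) ` ?K)) (\<alpha> \<circ> p) (\<beta> \<circ> p)"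
  proof (rule commensuration_dataI[OF K g])
    \<comment> \<open>Composing with \<open>p\<close> creates no new values, so finiteness and
      membership in the larger double coset are inherited from \<open>A\<close>.\<close>
    have im: "(\<alpha> \<circ> p) ` ?K \<subseteq> A" "(\<beta> \<circ> p) ` ?K \<subseteq> set_inv A" using \<alpha>A \<beta>A p by auto
    show "finite ((\<alpha> \<circ> p) ` ?K)" "finite ((\<beta> \<circ> p) ` ?K)"
      using im A(1) iA(1) finite_subset by blast+
    show "(\<alpha> \<circ> p) ` ?K \<subseteq> ?K #> g <#> ?K" "(\<beta> \<circ> p) ` ?K \<subseteq> set_inv (?K #> g <#> ?K)"
      using im AK iA(2) by blast+
    fix k assume k: "k \<in> ?K"
    define t where "t = p k"
    have tQ: "t \<in> Q" using p[OF k] by (simp add: t_def)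
    obtain n where n: "n \<in> N" "k = t \<otimes> n" using p[OF k] by (auto simp: t_def l_coset_def)
    have c: "t \<in> carrier G" "n \<in> carrier G" "\<alpha> t \<in> carrier G" "\<beta> t \<in> carrier G"
      using tQ n Qc Nc \<alpha>A \<beta>A Ac iA(3) by auto
    obtain n1 where n1: "n1 \<in> N" "n \<otimes> \<alpha> t = \<alpha> t \<otimes> n1" using swap n c by blast
    obtain n2 where n2: "n2 \<in> N" "n \<otimes> \<beta> t = \<beta> t \<otimes> n2" using swap n c by blast
    have nc: "n1 \<in> carrier G" "n2 \<in> carrier G" using n1 n2 Nc by auto
    obtain q where q: "q \<in> Q" "t \<otimes> \<alpha> t = g \<otimes> q" using \<alpha>[OF tQ] by (auto simp: l_coset_def)
    have "k \<otimes> \<alpha> t = t \<otimes> \<alpha> t \<otimes> n1" using c nc n n1 by (simp add: m_assoc)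
    also have "\<dots> = g \<otimes> (q \<otimes> n1)" unfolding q using g q Qc nc by (auto simp: m_assoc subsetD)
    finally show "k \<otimes> (\<alpha> \<circ> p) k \<in> g <# ?K"
      using q n1 by (auto simp: t_def l_coset_def set_mult_def)
    have "g \<otimes> k \<otimes> \<beta> t = g \<otimes> t \<otimes> \<beta> t \<otimes> n2" using g c nc n n2 by (simp add: m_assoc)
    then show "g \<otimes> k \<otimes> (\<beta> \<circ> p) k \<in> ?K"
      using \<beta>[OF tQ] n2 by (auto simp: t_def set_mult_def)
  qed
  then show ?thesis by blast
qed

end

theorem lemma10:
  fixes G :: "('a, 'b) monoid_scheme" and Q N :: "'a set"
  assumes "group G" and "quasi_normal Q G" and "N \<lhd> G"
  shows "quasi_normal (generate G (Q \<union> N)) G \<and>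
    (\<exists>(T :: 'a set)
       (A :: 'a \<Rightarrow> 'a set) (\<alpha> :: 'a \<Rightarrow> 'a \<Rightarrow> 'a) (\<beta> :: 'a \<Rightarrow> 'a \<Rightarrow> 'a)
       (A' :: 'a \<Rightarrow> 'a set) (\<alpha>' :: 'a \<Rightarrow> 'a \<Rightarrow> 'a) (\<beta>' :: 'a \<Rightarrow> 'a \<Rightarrow> 'a).
       T \<subseteq> Q \<and> transversal T N (generate G (Q \<union> N)) G \<and>
       (\<forall>g\<in>carrier G.
          commensuration_data g Q G (A g) (\<alpha> g) (\<beta> g) \<and>
          commensuration_data g (generate G (Q \<union> N)) G (A' g) (\<alpha>' g) (\<beta>' g)) \<and>
       (\<forall>g\<in>carrier G. \<forall>t\<in>T. \<forall>n\<in>N.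
          \<alpha>' g (t \<otimes>\<^bsub>G\<^esub> n) = \<alpha> g t \<and> \<beta>' g (t \<otimes>\<^bsub>G\<^esub> n) = \<beta> g t))"
proof -
  interpret group G by fact
  let ?K = "Q <#>\<^bsub>G\<^esub> N"
  have Q: "subgroup Q G" and comm: "commensurator Q G = carrier G"
    using assms(2) by (auto simp: quasi_normal_def)
  have N: "subgroup N G" using assms(3) by (rule normal_imp_subgroup)
  note gen = generate_Un_normal[OF Q assms(3)]
  obtain T p where T: "T \<subseteq> Q" "transversal T N ?K G"
    and p: "\<And>k. k \<in> ?K \<Longrightarrow> p k \<in> T \<and> k \<in> p k <#\<^bsub>G\<^esub> N"
    and pt: "\<And>t n. t \<in> T \<Longrightarrow> n \<in> N \<Longrightarrow> p (t \<otimes>\<^bsub>G\<^esub> n) = t"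
    using transversal_projection[OF Q N] by metis
  obtain A \<alpha> \<beta> where data: "\<forall>g\<in>carrier G. commensuration_data g Q G (A g) (\<alpha> g) (\<beta> g)"
    using commensuration_data_exists[OF Q] comm by metis
  \<comment> \<open>One projection \<open>p\<close>, and so one transversal \<open>T\<close>, serves
    all \<open>g\<close> at once, as \<open>p\<close> was built without reference to
    \<open>g\<close>.\<close>
  have "\<forall>g\<in>carrier G. \<exists>A'. commensuration_data g ?K G A' (\<alpha> g \<circ> p) (\<beta> g \<circ> p)"
    using commensuration_data_set_mult[OF Q assms(3), of _ _ _ _ p] data p T(1) by blast
  then obtain A' where data': "\<forall>g\<in>carrier G. commensuration_data g ?K G (A' g) (\<alpha> g \<circ> p) (\<beta> g \<circ> p)"
    by metis
  have "subgroup (generate G (Q \<union> N)) G"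
    using Q N by (intro generate_is_subgroup) (auto dest: subgroup.subset)
  then have "quasi_normal (generate G (Q \<union> N)) G"
    \<comment> \<open>Commensuration data for \<open>g\<close> include membership of
      \<open>g\<close> in the commensurator, so data for all \<open>g\<close> give
      quasi-normality.\<close>
    using data' by (auto simp: gen quasi_normal_def commensuration_data_def commensurator_def)
  moreover have "\<forall>g\<in>carrier G. \<forall>t\<in>T. \<forall>n\<in>N.
      (\<alpha> g \<circ> p) (t \<otimes>\<^bsub>G\<^esub> n) = \<alpha> g t \<and> (\<beta> g \<circ> p) (t \<otimes>\<^bsub>G\<^esub> n) = \<beta> g t"
    by (simp add: pt)
  ultimately show ?thesis
    unfolding gen
    apply (intro conjI)
     apply assumption
    apply (rule exI[of _ T], rule exI[of _ A], rule exI[of _ \<alpha>], rule exI[of _ \<beta>], rule exI[of _ A'],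
        rule exI[of _ "\<lambda>g. \<alpha> g \<circ> p"], rule exI[of _ "\<lambda>g. \<beta> g \<circ> p"])
    using T data data' by blast
qed

end
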